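(* Let $M$ be a smooth manifold of dimension $2n$ with a non-degenerate almost Poisson tensor $\mathbf J$, and let $\mathbf\Omega=\mathbf J^{-1}$ be the associated fundamental 2-form. Then $\mathbf\Omega$ is symplectic if and only if the tensor $\mathbf J=\mathbf\Omega^{-1}$ is Poisson.
   Context: An almost Poisson tensor $\mathbf J$ on $M$ is a smooth antisymmetric contravariant 2-tensor field, with components $\mathbf J^{ij}=-\mathbf J^{ji}$ in local coordinates $\{x^i\}$ and associated bracket $[f,g]=\mathbf J^{ij}\frac{\partial f}{\partial x^i}\frac{\partial g}{\partial x^j}$ (summation over repeated indices). It is non-degenerate if it has maximal rank $2n$ at every point of $M$. It is Poisson if its bracket satisfies the Jacobi identity, i.e. if in local coordinates, for all $i,j,k$, $$\mathbf J^{lk}\frac{\partial\mathbf J^{ij}}{\partial x^l}+\mathbf J^{li}\frac{\partial\mathbf J^{jk}}{\partial x^l}+\mathbf J^{lj}\frac{\partial\mathbf J^{ki}}{\partial x^l}=0.$$ The fundamental 2-form is $\mathbf\Omega=\mathbf\Omega_{ij}\,dx^i\wedge dx^j$, where the antisymmetric matrix $(\mathbf\Omega_{ij})$ is the inverse of the matrix $(\mathbf J^{ij})$. It is automatically non-degenerate, and it is called symplectic if $d\mathbf\Omega=0$, i.e. if $\frac{\partial\mathbf\Omega_{ij}}{\partial x^k}+\frac{\partial\mathbf\Omega_{jk}}{\partial x^i}+\frac{\partial\mathbf\Omega_{ki}}{\partial x^j}=0$ for all $i,j,k$. *)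

theory Defs
  imports "HOL-Analysis.Analysis"
begin

primrec Ck_on :: "nat \<Rightarrow> ('v::real_normed_vector \<Rightarrow> 'w::real_normed_vector) \<Rightarrow> 'v set \<Rightarrow> bool" where
  "Ck_on 0 f S \<longleftrightarrow> continuous_on S f"
| "Ck_on (Suc k) f S \<longleftrightarrow>
     (\<forall>x\<in>S. f differentiable (at x)) \<and> (\<forall>v. Ck_on k (\<lambda>x. frechet_derivative f (at x) v) S)"

text \<open>Only meaningful for open \<open>S\<close>, which is how it is used below.\<close>

definition smooth_on :: "('v::real_normed_vector \<Rightarrow> 'w::real_normed_vector) \<Rightarrow> 'v set \<Rightarrow> bool" where
  "smooth_on f S \<longleftrightarrow> (\<forall>k. Ck_on k f S)"

text \<open>
  A chart is a pair of a domain and a coordinate map. The coordinate map is a total function whose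
  values outside the domain are irrelevant. The model space is \<^typ>\<open>real^'d\<close>, so the dimension of
  the manifold is the cardinality of \<open>'d\<close>.
\<close>

type_synonym ('a, 'd) chart = "'a set \<times> ('a \<Rightarrow> real^'d)"

definition chart_image :: "('a, 'd::finite) chart \<Rightarrow> (real^'d) set" where
  "chart_image c = snd c ` fst c"

definition chart_inv :: "('a, 'd::finite) chart \<Rightarrow> real^'d \<Rightarrow> 'a" where
  "chart_inv c = inv_into (fst c) (snd c)"

definition is_chart :: "'a topology \<Rightarrow> ('a, 'd::finite) chart \<Rightarrow> bool" where
  "is_chart X c \<longleftrightarrow> openin X (fst c) \<and> open (chart_image c) \<and>
     homeomorphic_map (subtopology X (fst c)) (top_of_set (chart_image c)) (snd c)"

definition compatible_charts :: "('a, 'd::finite) chart \<Rightarrow> ('a, 'd) chart \<Rightarrow> bool" where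
  "compatible_charts c c' \<longleftrightarrow>
     smooth_on (snd c' \<circ> chart_inv c) (snd c ` (fst c \<inter> fst c')) \<and>
     smooth_on (snd c \<circ> chart_inv c') (snd c' ` (fst c \<inter> fst c'))"

text \<open>The atlas \<open>A\<close> is the maximal one, so that it consists of all local coordinate systems.\<close>

definition smooth_manifold :: "'a topology \<Rightarrow> ('a, 'd::finite) chart set \<Rightarrow> bool" where
  "smooth_manifold X A \<longleftrightarrow>
     Hausdorff_space X \<and> second_countable X \<and>
     (\<forall>c\<in>A. is_chart X c) \<and>
     (\<Union>c\<in>A. fst c) = topspace X \<and>
     (\<forall>c\<in>A. \<forall>c'\<in>A. compatible_charts c c') \<and>
     (\<forall>c. is_chart X c \<and> (\<forall>c'\<in>A. compatible_charts c c') \<longrightarrow> c \<in> A)"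

definition smooth_in_chart ::
    "('a, 'd::finite) chart \<Rightarrow> ('a \<Rightarrow> 'w::real_normed_vector) \<Rightarrow> bool" where
  "smooth_in_chart c f \<longleftrightarrow> smooth_on (f \<circ> chart_inv c) (chart_image c)"

definition smooth_function :: "('a, 'd::finite) chart set \<Rightarrow> ('a \<Rightarrow> real) \<Rightarrow> bool" where
  "smooth_function A f \<longleftrightarrow> (\<forall>c\<in>A. smooth_in_chart c f)"

text \<open>\<open>pd c l f p\<close> is \<open>\<partial>f / \<partial>x\<^sup>l\<close> at the point \<open>p\<close>, for the coordinates \<open>x\<close> given by the chart \<open>c\<close>.\<close>

definition pd :: "('a, 'd::finite) chart \<Rightarrow> 'd \<Rightarrow> ('a \<Rightarrow> real) \<Rightarrow> 'a \<Rightarrow> real" where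
  "pd c l f p = frechet_derivative (f \<circ> chart_inv c) (at (snd c p)) (axis l 1)"

text \<open>
  A tensor field is given by its matrices of components in all charts: \<open>T c p $ i $ j\<close> is the
  component with indices \<open>i, j\<close> at the point \<open>p\<close> in the coordinates \<open>c\<close>. Components in different
  charts are related by the tensor transformation law.
\<close>

type_synonym ('a, 'd) tensor2 = "('a, 'd) chart \<Rightarrow> 'a \<Rightarrow> real^'d^'d"

definition smooth_components :: "('a, 'd::finite) chart set \<Rightarrow> ('a, 'd) tensor2 \<Rightarrow> bool" where
  "smooth_components A T \<longleftrightarrow> (\<forall>c\<in>A. smooth_in_chart c (T c))"

definition antisymmetric_components :: "('a, 'd::finite) chart set \<Rightarrow> ('a, 'd) tensor2 \<Rightarrow> bool" where
  "antisymmetric_components A T \<longleftrightarrow>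
     (\<forall>c\<in>A. \<forall>p\<in>fst c. \<forall>i j. T c p $ i $ j = - T c p $ j $ i)"

definition contravariant :: "('a, 'd::finite) chart set \<Rightarrow> ('a, 'd) tensor2 \<Rightarrow> bool" where
  "contravariant A T \<longleftrightarrow>
     (\<forall>c\<in>A. \<forall>c'\<in>A. \<forall>p \<in> fst c \<inter> fst c'. \<forall>a b.
        T c' p $ a $ b =
          (\<Sum>i\<in>UNIV. \<Sum>j\<in>UNIV.
             T c p $ i $ j * pd c i (\<lambda>q. snd c' q $ a) p * pd c j (\<lambda>q. snd c' q $ b) p))"

definition covariant :: "('a, 'd::finite) chart set \<Rightarrow> ('a, 'd) tensor2 \<Rightarrow> bool" where
  "covariant A T \<longleftrightarrow>
     (\<forall>c\<in>A. \<forall>c'\<in>A. \<forall>p \<in> fst c \<inter> fst c'. \<forall>i j.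
        T c p $ i $ j =
          (\<Sum>a\<in>UNIV. \<Sum>b\<in>UNIV.
             T c' p $ a $ b * pd c i (\<lambda>q. snd c' q $ a) p * pd c j (\<lambda>q. snd c' q $ b) p))"

definition nondegenerate :: "('a, 'd::finite) chart set \<Rightarrow> ('a, 'd) tensor2 \<Rightarrow> bool" where
  "nondegenerate A T \<longleftrightarrow> (\<forall>c\<in>A. \<forall>p\<in>fst c. rank (T c p) = CARD('d))"

definition almost_poisson :: "('a, 'd::finite) chart set \<Rightarrow> ('a, 'd) tensor2 \<Rightarrow> bool" where
  "almost_poisson A J \<longleftrightarrow>
     contravariant A J \<and> antisymmetric_components A J \<and> smooth_components A J"

definition chart_bracket ::
    "('a, 'd::finite) chart \<Rightarrow> ('a, 'd) tensor2 \<Rightarrow> ('a \<Rightarrow> real) \<Rightarrow> ('a \<Rightarrow> real) \<Rightarrow> 'a \<Rightarrow> real" where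
  "chart_bracket c J f g p =
     (\<Sum>i\<in>UNIV. \<Sum>j\<in>UNIV. J c p $ i $ j * pd c i f p * pd c j g p)"

text \<open>For a contravariant \<open>J\<close> and smooth \<open>f, g\<close> the value does not depend on the chosen chart around \<open>p\<close>.\<close>

definition bracket ::
    "('a, 'd::finite) chart set \<Rightarrow> ('a, 'd) tensor2 \<Rightarrow> ('a \<Rightarrow> real) \<Rightarrow> ('a \<Rightarrow> real) \<Rightarrow> 'a \<Rightarrow> real" where
  "bracket A J f g p = chart_bracket (SOME c. c \<in> A \<and> p \<in> fst c) J f g p"

definition poisson :: "'a topology \<Rightarrow> ('a, 'd::finite) chart set \<Rightarrow> ('a, 'd) tensor2 \<Rightarrow> bool" where
  "poisson X A J \<longleftrightarrow> almost_poisson A J \<and>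
     (\<forall>f g h. smooth_function A f \<and> smooth_function A g \<and> smooth_function A h \<longrightarrow>
        (\<forall>p\<in>topspace X.
           bracket A J (bracket A J f g) h p + bracket A J (bracket A J g h) f p +
           bracket A J (bracket A J h f) g p = 0))"

text \<open>
  The components of \<open>\<Omega>\<close> are the coefficients \<open>\<Omega> c p $ i $ j\<close> of \<open>dx\<^sup>i \<and> dx\<^sup>j\<close> with both indices summed
  over all values. The factor relating the coefficients of \<open>d\<Omega>\<close> to the cyclic sum in
  \<open>closed_form\<close> depends on this normalisation, but it is a nonzero constant.
\<close>

definition two_form :: "('a, 'd::finite) chart set \<Rightarrow> ('a, 'd) tensor2 \<Rightarrow> bool" where
  "two_form A \<Omega> \<longleftrightarrow>
     covariant A \<Omega> \<and> antisymmetric_components A \<Omega> \<and> smooth_components A \<Omega>"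

definition closed_form :: "('a, 'd::finite) chart set \<Rightarrow> ('a, 'd) tensor2 \<Rightarrow> bool" where
  "closed_form A \<Omega> \<longleftrightarrow>
     (\<forall>c\<in>A. \<forall>p\<in>fst c. \<forall>i j k.
        pd c k (\<lambda>q. \<Omega> c q $ i $ j) p + pd c i (\<lambda>q. \<Omega> c q $ j $ k) p +
        pd c j (\<lambda>q. \<Omega> c q $ k $ i) p = 0)"

definition symplectic :: "('a, 'd::finite) chart set \<Rightarrow> ('a, 'd) tensor2 \<Rightarrow> bool" where
  "symplectic A \<Omega> \<longleftrightarrow> two_form A \<Omega> \<and> nondegenerate A \<Omega> \<and> closed_form A \<Omega>"

definition fundamental_form :: "('a, 'd::finite) tensor2 \<Rightarrow> ('a, 'd) tensor2" where
  "fundamental_form J = (\<lambda>c p. matrix_inv (J c p))"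

end

theory Submission
  imports Defs
begin

text \<open>
  Fix a chart and write \<open>J\<close> and \<open>\<Omega> = J\<^sup>-\<^sup>1\<close> for the matrices of components, regarded as functions
  of the coordinates. For a function \<open>f\<close> let \<open>X\<^sub>f = J (grad f)\<close>, so that
  \<open>{f, g} = \<langle>grad f, J (grad g)\<rangle>\<close> and \<open>{F, h}\<close> is the derivative of \<open>F\<close> along \<open>X\<^sub>h\<close>. Differentiating
  \<open>{f, g}\<close> along \<open>X\<^sub>h\<close> produces two terms with second derivatives and one with the derivative of
  \<open>J\<close>. Second derivatives are symmetric and \<open>J\<close> is antisymmetric, so the former cancel in the
  cyclic sum; inserting \<open>DJ = - J D\<Omega> J\<close> in the latter gives
  \<open>{{f, g}, h} + {{g, h}, f} + {{h, f}, g}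
      = \<langle>X\<^sub>f, D\<Omega>(X\<^sub>h) X\<^sub>g\<rangle> + \<langle>X\<^sub>g, D\<Omega>(X\<^sub>f) X\<^sub>h\<rangle> + \<langle>X\<^sub>h, D\<Omega>(X\<^sub>g) X\<^sub>f\<rangle>\<close>,
  that is, up to a constant, \<open>d\<Omega>(X\<^sub>f, X\<^sub>g, X\<^sub>h)\<close> (lemma \<open>jacobiator_eq_cyclic_derivative\<close>). Hence
  \<open>d\<Omega> = 0\<close> implies the Jacobi identity. Conversely, as \<open>J\<close> is invertible, every tangent vector
  at a point is \<open>X\<^sub>f\<close> for some globally defined smooth \<open>f\<close>: a bump function times an affine function
  of the coordinates (lemma \<open>exists_smooth_function_with_gradient\<close>). So the Jacobi identity
  implies \<open>d\<Omega> = 0\<close>.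

  The passage between the manifold and a chart rests on the independence of the bracket from the
  chart (lemma \<open>bracket_eq_chart_bracket\<close>). The remaining requirements on a symplectic form, namely
  the covariant transformation law, antisymmetry, smoothness and nondegeneracy of \<open>J\<^sup>-\<^sup>1\<close>, hold
  for every nondegenerate almost Poisson tensor (lemma \<open>two_form_fundamental_form\<close>).
\<close>

section \<open>Functions of class \<open>C\<^sup>k\<close> on open sets\<close>

lemma Ck_on_cong:
  assumes "open S" "\<And>x. x \<in> S \<Longrightarrow> f x = g x" "Ck_on k f S"
  shows "Ck_on k g S"
  using assms(2,3)
proof (induction k arbitrary: f g)
  case 0
  then show ?case by (simp cong: continuous_on_cong)
next
  case (Suc k)
  have D: "(g has_derivative frechet_derivative f (at x)) (at x)" if "x \<in> S" for x
  proof (rule has_derivative_transform_within_open[OF _ \<open>open S\<close> that Suc.prems(1)])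
    show "(f has_derivative frechet_derivative f (at x)) (at x)"
      using Suc.prems(2) that by (simp add: frechet_derivative_works)
  qed
  have "Ck_on k (\<lambda>x. frechet_derivative g (at x) v) S" for v
  proof (rule Suc.IH)
    show "Ck_on k (\<lambda>x. frechet_derivative f (at x) v) S" using Suc.prems(2) by simp
    show "frechet_derivative f (at x) v = frechet_derivative g (at x) v" if "x \<in> S" for x
      using frechet_derivative_at[OF D[OF that]] by simp
  qed
  then show ?case using D by (auto simp: differentiable_def)
qed

lemma Ck_on_Suc_intro:
  assumes "open S" "\<And>x. x \<in> S \<Longrightarrow> (f has_derivative f' x) (at x)"
    and "\<And>v. Ck_on k (\<lambda>x. f' x v) S"
  shows "Ck_on (Suc k) f S"
proof -
  have "Ck_on k (\<lambda>x. frechet_derivative f (at x) v) S" for v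
  proof (rule Ck_on_cong[OF assms(1) _ assms(3)[of v]])
    show "f' x v = frechet_derivative f (at x) v" if "x \<in> S" for x
      using frechet_derivative_at[OF assms(2)[OF that]] by simp
  qed
  then show ?thesis using assms(2) by (auto simp: differentiable_def)
qed

lemma Ck_on_has_derivative:
  assumes "Ck_on (Suc k) f S" "x \<in> S"
  shows "(f has_derivative frechet_derivative f (at x)) (at x)"
  using assms by (simp add: frechet_derivative_works)

lemma Ck_on_SucD: "Ck_on (Suc k) f S \<Longrightarrow> Ck_on k f S"
proof (induction k arbitrary: f)
  case 0
  then show ?case
    by (auto intro!: continuous_at_imp_continuous_on differentiable_imp_continuous_within)
next
  case (Suc k)
  have "Ck_on k (\<lambda>x. frechet_derivative f (at x) v) S" for v
  proof (rule Suc.IH)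
    show "Ck_on (Suc k) (\<lambda>x. frechet_derivative f (at x) v) S"
      using Suc.prems unfolding Ck_on.simps(2)[of "Suc k"] by blast
  qed
  then show ?case using Suc.prems by simp
qed

lemma Ck_on_Un:
  assumes "open S" "open T" "Ck_on k f S" "Ck_on k f T"
  shows "Ck_on k f (S \<union> T)"
  using assms(3,4) by (induction k arbitrary: f) (auto simp: assms intro: continuous_on_open_Un)

lemma Ck_on_const: "Ck_on k (\<lambda>x. c) S"
  by (induction k arbitrary: c) auto

lemma Ck_on_bounded_linear:
  assumes "open S" "bounded_linear L" "Ck_on k f S"
  shows "Ck_on k (\<lambda>x. L (f x)) S"
  using assms(3)
proof (induction k arbitrary: f)
  case 0
  then show ?case using assms(2) by (simp add: bounded_linear.continuous_on)
next
  case (Suc k)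
  show ?case
  proof (rule Ck_on_Suc_intro[OF assms(1)])
    fix x assume "x \<in> S"
    show "((\<lambda>x. L (f x)) has_derivative (\<lambda>v. L (frechet_derivative f (at x) v))) (at x)"
      by (rule bounded_linear.has_derivative[OF assms(2) Ck_on_has_derivative[OF Suc.prems \<open>x \<in> S\<close>]])
  qed (use Suc in auto)
qed

lemma Ck_on_add:
  assumes "open S" "Ck_on k f S" "Ck_on k g S"
  shows "Ck_on k (\<lambda>x. f x + g x) S"
  using assms(2,3)
proof (induction k arbitrary: f g)
  case 0
  then show ?case by (simp add: continuous_on_add)
next
  case (Suc k)
  show ?case
    by (rule Ck_on_Suc_intro[OF assms(1) has_derivative_add[OF
            Ck_on_has_derivative[OF Suc.prems(1)] Ck_on_has_derivative[OF Suc.prems(2)]]])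
       (use Suc in auto)
qed

lemma Ck_on_sum:
  assumes "open S" "\<And>i. i \<in> I \<Longrightarrow> Ck_on k (f i) S"
  shows "Ck_on k (\<lambda>x. \<Sum>i\<in>I. f i x) S"
  using assms(2)
  by (induction I rule: infinite_finite_induct) (auto intro!: Ck_on_add Ck_on_const assms(1))

lemma Ck_on_bilinear:
  assumes "open S" "bounded_bilinear B" "Ck_on k f S" "Ck_on k g S"
  shows "Ck_on k (\<lambda>x. B (f x) (g x)) S"
  using assms(3,4)
proof (induction k arbitrary: f g)
  case 0
  then show ?case using assms(2) by (simp add: bounded_bilinear.continuous_on)
next
  case (Suc k)
  show ?case
  proof (rule Ck_on_Suc_intro[OF assms(1)])
    fix x assume "x \<in> S"
    show "((\<lambda>x. B (f x) (g x)) has_derivative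
        (\<lambda>v. B (f x) (frechet_derivative g (at x) v) + B (frechet_derivative f (at x) v) (g x))) (at x)"
      by (rule bounded_bilinear.FDERIV[OF assms(2) Ck_on_has_derivative[OF Suc.prems(1) \<open>x \<in> S\<close>]
            Ck_on_has_derivative[OF Suc.prems(2) \<open>x \<in> S\<close>]])
  next
    fix v
    show "Ck_on k (\<lambda>x. B (f x) (frechet_derivative g (at x) v) + B (frechet_derivative f (at x) v) (g x)) S"
      using Suc Ck_on_SucD[OF Suc.prems(1)] Ck_on_SucD[OF Suc.prems(2)]
      by (intro Ck_on_add assms(1)) auto
  qed
qed

lemmas Ck_on_mult = Ck_on_bilinear[OF _ bounded_bilinear_mult]
lemmas Ck_on_scaleR = Ck_on_bilinear[OF _ bounded_bilinear_scaleR]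
lemmas Ck_on_inner = Ck_on_bilinear[OF _ bounded_bilinear_inner]

lemma Ck_on_prod:
  fixes f :: "'i \<Rightarrow> 'v::real_normed_vector \<Rightarrow> real"
  assumes "open S" "\<And>i. i \<in> I \<Longrightarrow> Ck_on k (f i) S"
  shows "Ck_on k (\<lambda>x. \<Prod>i\<in>I. f i x) S"
  using assms(2)
  by (induction I rule: infinite_finite_induct) (auto intro!: Ck_on_mult Ck_on_const assms(1))

lemma Ck_on_id: "open S \<Longrightarrow> Ck_on k (\<lambda>x. x) S"
proof (cases k)
  case (Suc m)
  assume "open S"
  then show ?thesis unfolding Suc
    by (rule Ck_on_Suc_intro[where f' = "\<lambda>x v. v"]) (auto intro: Ck_on_const)
qed simp

text \<open>A direction of differentiation that varies with the point is resolved into its coordinates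
  in a basis; this is why the intermediate space is Euclidean.\<close>

lemma Ck_on_compose:
  fixes f :: "'v::real_normed_vector \<Rightarrow> 'e::euclidean_space" and g :: "'e \<Rightarrow> 'w::real_normed_vector"
  assumes "open S" "open T" "f ` S \<subseteq> T" "Ck_on k f S" "Ck_on k g T"
  shows "Ck_on k (\<lambda>x. g (f x)) S"
  using assms(4,5)
proof (induction k arbitrary: g)
  case 0
  then show ?case using assms(3) by (auto intro: continuous_on_compose2)
next
  case (Suc k)
  let ?Df = "\<lambda>x. frechet_derivative f (at x)" and ?Dg = "\<lambda>y. frechet_derivative g (at y)"
  show ?case
  proof (rule Ck_on_Suc_intro[OF assms(1)])
    fix x assume x: "x \<in> S"
    then have fx: "f x \<in> T" using assms(3) by auto
    have g: "(g has_derivative ?Dg (f x)) (at (f x))"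
      by (rule Ck_on_has_derivative[OF Suc.prems(2) fx])
    have expand: "?Dg (f x) w = (\<Sum>b\<in>Basis. (w \<bullet> b) *\<^sub>R ?Dg (f x) b)" for w
    proof -
      interpret bounded_linear "?Dg (f x)" using g by (rule has_derivative_bounded_linear)
      have "?Dg (f x) w = ?Dg (f x) (\<Sum>b\<in>Basis. (w \<bullet> b) *\<^sub>R b)" by (simp add: euclidean_representation)
      then show ?thesis by (simp add: sum scaleR)
    qed
    have "((g \<circ> f) has_derivative (?Dg (f x) \<circ> ?Df x)) (at x)"
      by (rule diff_chain_at[OF Ck_on_has_derivative[OF Suc.prems(1) x] g])
    moreover have "?Dg (f x) \<circ> ?Df x = (\<lambda>v. \<Sum>b\<in>Basis. (?Df x v \<bullet> b) *\<^sub>R ?Dg (f x) b)"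
      unfolding o_def by (rule ext, rule expand)
    ultimately show "((\<lambda>x. g (f x)) has_derivative
        (\<lambda>v. \<Sum>b\<in>Basis. (?Df x v \<bullet> b) *\<^sub>R ?Dg (f x) b)) (at x)"
      by (simp only: o_def)
  next
    fix v
    have "Ck_on k (\<lambda>x. ?Dg (f x) b) S" for b
      using Suc.prems(2) by (intro Suc.IH[OF Ck_on_SucD[OF Suc.prems(1)]]) simp
    moreover have "Ck_on k (\<lambda>x. ?Df x v) S" using Suc.prems(1) by simp
    ultimately show "Ck_on k (\<lambda>x. \<Sum>b\<in>Basis. (?Df x v \<bullet> b) *\<^sub>R ?Dg (f x) b) S"
      by (intro Ck_on_sum Ck_on_scaleR Ck_on_inner Ck_on_const assms(1))
  qed
qed

lemma Ck_on_inverse: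
  fixes f :: "'v::real_normed_vector \<Rightarrow> real"
  assumes "open S" "\<And>x. x \<in> S \<Longrightarrow> f x \<noteq> 0" "Ck_on k f S"
  shows "Ck_on k (\<lambda>x. inverse (f x)) S"
  using assms(3)
proof (induction k)
  case 0
  then show ?case using assms(2) by (auto intro: continuous_on_inverse)
next
  case (Suc k)
  show ?case
  proof (rule Ck_on_Suc_intro[OF assms(1)])
    fix x assume x: "x \<in> S"
    show "((\<lambda>x. inverse (f x)) has_derivative
        (\<lambda>v. - (inverse (f x) * frechet_derivative f (at x) v * inverse (f x)))) (at x)"
      by (rule Deriv.has_derivative_inverse[OF assms(2)[OF x] Ck_on_has_derivative[OF Suc.prems x]])
  next
    fix v
    have "Ck_on k (\<lambda>x. inverse (f x)) S" "Ck_on k (\<lambda>x. frechet_derivative f (at x) v) S"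
      using Suc Ck_on_SucD[OF Suc.prems] by auto
    then show "Ck_on k (\<lambda>x. - (inverse (f x) * frechet_derivative f (at x) v * inverse (f x))) S"
      by (intro Ck_on_bounded_linear[OF assms(1) bounded_linear_minus[OF bounded_linear_ident]]
            Ck_on_mult assms(1))
  qed
qed

lemma Ck_on_component:
  assumes "open S" "Ck_on k f S"
  shows "Ck_on k (\<lambda>x. f x $ i) S"
  using Ck_on_bounded_linear[OF assms(1) bounded_linear_vec_nth assms(2)] .

lemma Ck_on_componentwise:
  fixes f :: "'v::real_normed_vector \<Rightarrow> 'e::euclidean_space"
  assumes "open S" "\<And>b. b \<in> Basis \<Longrightarrow> Ck_on k (\<lambda>x. f x \<bullet> b) S"
  shows "Ck_on k f S"
proof -
  have "Ck_on k (\<lambda>x. \<Sum>b\<in>Basis. (f x \<bullet> b) *\<^sub>R b) S"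
    by (intro Ck_on_sum Ck_on_scaleR Ck_on_const assms)
  then show ?thesis by (simp add: euclidean_representation)
qed

lemma Ck_on_matrixI:
  fixes M :: "'v::real_normed_vector \<Rightarrow> real^'n^'m"
  assumes "open S" "\<And>i j. Ck_on k (\<lambda>x. M x $ i $ j) S"
  shows "Ck_on k M S"
  by (rule Ck_on_componentwise[OF assms(1)])
     (use assms(2) in \<open>auto simp: Basis_vec_def inner_axis\<close>)

lemma matrix_inv_mult:
  fixes K :: "real^'d^'d"
  assumes "invertible K"
  shows "K ** matrix_inv K = mat 1" "matrix_inv K ** K = mat 1"
proof -
  have "K ** matrix_inv K = mat 1 \<and> matrix_inv K ** K = mat 1"
    using assms unfolding invertible_def matrix_inv_def by (rule someI_ex)
  then show "K ** matrix_inv K = mat 1" "matrix_inv K ** K = mat 1" by auto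
qed

lemma Ck_on_matrix_inv:
  fixes M :: "'v::real_normed_vector \<Rightarrow> real^'n^'n"
  assumes S: "open S" and inv: "\<And>x. x \<in> S \<Longrightarrow> invertible (M x)" and M: "Ck_on k M S"
  shows "Ck_on k (\<lambda>x. matrix_inv (M x)) S"
proof (rule Ck_on_matrixI[OF S])
  fix i j :: 'n
  let ?C = "\<lambda>x. (\<chi> a b. if b = i then axis j 1 $ a else M x $ a $ b) :: real^'n^'n"
  \<comment> \<open>Cramer's rule\<close>
  have eq: "det (?C x) * inverse (det (M x)) = matrix_inv (M x) $ i $ j" if "x \<in> S" for x
  proof -
    have d: "det (M x) \<noteq> 0" using inv[OF that] by (simp add: invertible_det_nz)
    have "M x *v (matrix_inv (M x) *v axis j 1) = axis j 1"
      by (simp add: matrix_vector_mul_assoc matrix_inv_mult(1)[OF inv[OF that]])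
    then have "matrix_inv (M x) *v axis j 1
        = (\<chi> k. det (\<chi> a b. if b = k then axis j 1 $ a else M x $ a $ b) / det (M x))"
      using cramer[OF d] by blast
    then have "(matrix_inv (M x) *v axis j 1) $ i = det (?C x) / det (M x)" by simp
    then show ?thesis by (simp add: matrix_vector_mul_component inner_axis divide_inverse)
  qed
  have entries: "Ck_on k (\<lambda>x. M x $ a $ b) S" for a b
    by (intro Ck_on_component S M)
  have det: "Ck_on k (\<lambda>x. det (N x)) S"
    if "\<And>a b. Ck_on k (\<lambda>x. N x $ a $ b) S" for N :: "'v \<Rightarrow> real^'n^'n"
    unfolding det_def by (intro Ck_on_sum Ck_on_mult Ck_on_prod Ck_on_const S that)
  have "Ck_on k (\<lambda>x. if b = i then axis j 1 $ a else M x $ a $ b) S" for a b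
    using entries by (cases "b = i") (simp_all add: Ck_on_const)
  then have "Ck_on k (\<lambda>x. det (?C x) * inverse (det (M x))) S"
    using inv by (intro Ck_on_mult Ck_on_inverse det S) (auto simp: invertible_det_nz entries)
  then show "Ck_on k (\<lambda>x. matrix_inv (M x) $ i $ j) S"
    by (rule Ck_on_cong[OF S, rotated]) (rule eq)
qed

section \<open>Bump functions\<close>

text \<open>\<open>flat m t = t\<^sup>-\<^sup>m exp (-1/t)\<close> for positive \<open>t\<close>, extended by zero. The derivative of
  \<open>flat m\<close> is a linear combination of \<open>flat (m + 1)\<close> and \<open>flat (m + 2)\<close>, so that the whole family
  is smooth at once.\<close>

definition flat :: "nat \<Rightarrow> real \<Rightarrow> real" where
  "flat m t = (if t > 0 then inverse t ^ m * exp (- inverse t) else 0)"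

lemma flat_has_derivative:
  "(flat m has_field_derivative (flat (m + 2) t - m * flat (m + 1) t)) (at t)"
proof -
  consider "t > 0" | "t < 0" | "t = 0" by linarith
  then show ?thesis
  proof cases
    case 1
    have pow: "((\<lambda>t. inverse t ^ m) has_field_derivative - m * inverse t ^ (m + 1)) (at t)"
      using DERIV_power[OF DERIV_inverse[of t], of m] 1 by (cases m) (simp_all add: algebra_simps)
    have "((\<lambda>t. exp (- inverse t)) has_field_derivative inverse t ^ 2 * exp (- inverse t)) (at t)"
      using 1 by (auto intro!: derivative_eq_intros simp: power2_eq_square)
    from DERIV_mult[OF pow this] have "((\<lambda>t. inverse t ^ m * exp (- inverse t)) has_field_derivative
        (flat (m + 2) t - m * flat (m + 1) t)) (at t)"
      using 1 by (simp add: flat_def power_add algebra_simps power2_eq_square)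
    then show ?thesis
      by (rule has_field_derivative_transform_within_open[where S = "{0<..}"]) (use 1 in \<open>auto simp: flat_def\<close>)
  next
    case 2
    have "((\<lambda>t. 0) has_field_derivative (flat (m + 2) t - m * flat (m + 1) t)) (at t)"
      using 2 by (simp add: flat_def)
    then show ?thesis
      by (rule has_field_derivative_transform_within_open[where S = "{..<0}"]) (use 2 in \<open>auto simp: flat_def\<close>)
  next
    case 3
    \<comment> \<open>the derivative at \<open>0\<close> vanishes because \<open>exp\<close> outgrows all powers\<close>
    have "((\<lambda>s::real. s ^ Suc m / exp s) \<longlongrightarrow> 0) at_top"
      by (rule tendsto_power_div_exp_0)
    then have "((\<lambda>t::real. inverse t ^ Suc m / exp (inverse t)) \<longlongrightarrow> 0) (at_right 0)"
      by (rule filterlim_compose) (rule filterlim_inverse_at_top_right)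
    moreover have "eventually (\<lambda>t. inverse t ^ Suc m / exp (inverse t) = flat m t / t) (at_right 0)"
      using eventually_at_right_less[of 0]
      by eventually_elim (auto simp: flat_def exp_minus field_simps)
    ultimately have "((\<lambda>t. flat m t / t) \<longlongrightarrow> 0) (at_right 0)"
      by (rule Lim_transform_eventually)
    moreover have "eventually (\<lambda>t. 0 = flat m t / t) (at_left 0)"
      using eventually_at_left_real[of "-1" 0] by (auto elim!: eventually_mono simp: flat_def)
    then have "((\<lambda>t. flat m t / t) \<longlongrightarrow> 0) (at_left 0)"
      by (rule Lim_transform_eventually[OF tendsto_const])
    ultimately have "((\<lambda>t. flat m t / t) \<longlongrightarrow> 0) (at 0)"
      by (simp add: filterlim_split_at)
    then show ?thesis using 3 by (simp add: flat_def has_field_derivative_iff)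
  qed
qed

lemma Ck_on_flat: "Ck_on k (flat m) UNIV"
proof (induction k arbitrary: m)
  case 0
  show ?case
    using flat_has_derivative[of m] by (auto intro!: continuous_at_imp_continuous_on DERIV_isCont)
next
  case (Suc k)
  show ?case
  proof (rule Ck_on_Suc_intro)
    show "(flat m has_derivative (\<lambda>v. (flat (m + 2) t + (- real m) * flat (m + 1) t) * v)) (at t)" for t
      using flat_has_derivative[of m t] by (simp add: has_field_derivative_def)
    show "Ck_on k (\<lambda>t. (flat (m + 2) t + (- real m) * flat (m + 1) t) * v) UNIV" for v
      by (intro Ck_on_mult Ck_on_add Ck_on_const Suc open_UNIV)
  qed simp
qed

lemma smooth_bump_exists:
  fixes a :: "'e::euclidean_space"
  assumes "r > 0"
  obtains \<beta> :: "'e \<Rightarrow> real" where "\<And>k. Ck_on k \<beta> UNIV" "\<beta> a \<noteq> 0"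
    "\<And>x. x \<notin> cball a r \<Longrightarrow> \<beta> x = 0"
proof
  let ?q = "\<lambda>x. r\<^sup>2 + - ((x - a) \<bullet> (x - a))"
  have "Ck_on k ?q UNIV" for k
    using Ck_on_add[OF open_UNIV Ck_on_id[OF open_UNIV] Ck_on_const[of k "- a" UNIV]]
    by (intro Ck_on_add Ck_on_const Ck_on_inner open_UNIV
          Ck_on_bounded_linear[OF open_UNIV bounded_linear_minus[OF bounded_linear_ident]]) simp_all
  then show "Ck_on k (\<lambda>x. flat 0 (?q x)) UNIV" for k
    by (intro Ck_on_compose[OF open_UNIV open_UNIV _ _ Ck_on_flat]) auto
  show "flat 0 (?q a) \<noteq> 0" using assms by (simp add: flat_def)
  show "flat 0 (?q x) = 0" if "x \<notin> cball a r" for x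
  proof -
    have "r < norm (x - a)" using that by (simp add: dist_norm norm_minus_commute)
    then have "r\<^sup>2 < (norm (x - a))\<^sup>2" using assms by (intro power_strict_mono) auto
    then show ?thesis by (simp add: flat_def power2_norm_eq_inner)
  qed
qed

section \<open>Symmetry of second derivatives\<close>

text \<open>Besides differentiability of \<open>f\<close> near \<open>a\<close>, only the differentiability at \<open>a\<close> of its
  directional derivative along \<open>u\<close> is needed (Young). The second difference is the increment of
  \<open>\<psi> s = f (a + t v + s u) - f (a + s u)\<close> over \<open>0 \<le> s \<le> t\<close>, to which the mean value theorem
  applies.\<close>

lemma second_difference_estimate:
  fixes f :: "'v::real_normed_vector \<Rightarrow> real"
  assumes "open S" "a \<in> S"
    and D: "\<And>x. x \<in> S \<Longrightarrow> (f has_derivative D x) (at x)"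
    and Du: "((\<lambda>x. D x u) has_derivative Du) (at a)"
    and "\<epsilon> > 0"
  shows "\<exists>\<delta>>0. \<forall>t. 0 < t \<and> t < \<delta> \<longrightarrow>
      \<bar>f (a + t *\<^sub>R u + t *\<^sub>R v) - f (a + t *\<^sub>R u) - f (a + t *\<^sub>R v) + f a - t\<^sup>2 * Du v\<bar> \<le> \<epsilon> * t\<^sup>2"
proof -
  \<comment> \<open>all points used lie within \<open>t M\<close> of \<open>a\<close>, and two errors \<open>e t M\<close> add up to \<open>\<epsilon> t\<close>\<close>
  define M where "M = norm u + norm v + 1"
  have M: "M > 0" by (simp add: M_def add_nonneg_pos)
  define e where "e = \<epsilon> / (2 * M)"
  have e: "e > 0" using \<open>\<epsilon> > 0\<close> M by (simp add: e_def)
  interpret Du: bounded_linear Du using Du by (rule has_derivative_bounded_linear)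
  obtain d where d: "d > 0"
    "\<And>y. norm (y - a) < d \<Longrightarrow> norm (D y u - D a u - Du (y - a)) \<le> e * norm (y - a)"
    using Du e unfolding has_derivative_at_alt by blast
  obtain r where r: "r > 0" "ball a r \<subseteq> S"
    using assms(1,2) by (meson open_contains_ball)
  have line: "((\<lambda>s. f (b + s *\<^sub>R u)) has_real_derivative D (b + s *\<^sub>R u) u) (at s)"
    if "b + s *\<^sub>R u \<in> S" for b s
  proof -
    interpret D: bounded_linear "D (b + s *\<^sub>R u)"
      using D[OF that] by (rule has_derivative_bounded_linear)
    have "((\<lambda>s. b + s *\<^sub>R u) has_derivative (\<lambda>h. h *\<^sub>R u)) (at s)"
      by (auto intro!: derivative_eq_intros)
    from diff_chain_at[OF this D[OF that]]
    show ?thesis by (simp add: o_def D.scaleR has_field_derivative_def mult_commute_abs)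
  qed
  show ?thesis
  proof (intro exI[of _ "min d r / M"] conjI allI impI)
    show "min d r / M > 0" using d(1) r(1) M by simp
    fix t assume "0 < t \<and> t < min d r / M"
    then have t: "0 < t" "t < min d r / M" by auto
    then have tM: "t * M < d" "t * M < r" using M by (auto simp: field_simps)
    have small: "norm (s *\<^sub>R u) \<le> t * M" "norm (s *\<^sub>R u + t *\<^sub>R v) \<le> t * M"
      if "0 \<le> s" "s \<le> t" for s
    proof -
      have "norm (s *\<^sub>R u) \<le> t * norm u" using that by (simp add: mult_right_mono)
      moreover have "norm (s *\<^sub>R u + t *\<^sub>R v) \<le> norm (s *\<^sub>R u) + t * norm v"
        using t(1) by (metis abs_of_pos norm_scaleR norm_triangle_ineq)
      moreover have "t * norm v \<ge> 0" using t by simp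
      moreover have "t * M = t * norm u + t * norm v + t" by (simp add: M_def algebra_simps)
      ultimately show "norm (s *\<^sub>R u) \<le> t * M" "norm (s *\<^sub>R u + t *\<^sub>R v) \<le> t * M"
        using t(1) \<open>t * M = t * norm u + t * norm v + t\<close> by linarith+
    qed
    have inS: "a + t *\<^sub>R v + s *\<^sub>R u \<in> S" "a + s *\<^sub>R u \<in> S" if "0 \<le> s" "s \<le> t" for s
    proof -
      have "dist a (a + t *\<^sub>R v + s *\<^sub>R u) = norm (s *\<^sub>R u + t *\<^sub>R v)"
        by (simp add: dist_norm norm_minus_commute add.commute algebra_simps)
      moreover have "dist a (a + s *\<^sub>R u) = norm (s *\<^sub>R u)" by (simp add: dist_norm)
      ultimately show "a + t *\<^sub>R v + s *\<^sub>R u \<in> S" "a + s *\<^sub>R u \<in> S"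
        using small[OF that] tM r(2) by (auto simp: subset_eq)
    qed
    define \<psi> where "\<psi> s = f (a + t *\<^sub>R v + s *\<^sub>R u) - f (a + s *\<^sub>R u)" for s
    have \<psi>: "(\<psi> has_real_derivative D (a + t *\<^sub>R v + s *\<^sub>R u) u - D (a + s *\<^sub>R u) u) (at s)"
      if "0 \<le> s" "s \<le> t" for s
      unfolding \<psi>_def using line[OF inS(1)[OF that]] line[OF inS(2)[OF that]] by (rule DERIV_diff)
    obtain \<xi> where \<xi>: "0 < \<xi>" "\<xi> < t"
      "\<psi> t - \<psi> 0 = (t - 0) * (D (a + t *\<^sub>R v + \<xi> *\<^sub>R u) u - D (a + \<xi> *\<^sub>R u) u)"
      using MVT2[OF t(1) \<psi>] by blast
    let ?x = "a + t *\<^sub>R v + \<xi> *\<^sub>R u" and ?y = "a + \<xi> *\<^sub>R u"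
    have s: "norm (?x - a) \<le> t * M" "norm (?y - a) \<le> t * M"
      using small[of \<xi>] \<xi> by (simp_all add: add.commute)
    have "\<bar>D ?x u - D a u - Du (?x - a)\<bar> \<le> e * (t * M)"
         "\<bar>D ?y u - D a u - Du (?y - a)\<bar> \<le> e * (t * M)"
      using d(2)[of ?x] d(2)[of ?y] s tM e mult_left_mono[of _ "t * M" e]
      by (auto intro: order_trans)
    moreover have "Du (?x - a) - Du (?y - a) = t * Du v"
      by (simp add: Du.add Du.scaleR)
    ultimately have "\<bar>D ?x u - D ?y u - t * Du v\<bar> \<le> 2 * (e * (t * M))" by linarith
    also have "\<dots> = \<epsilon> * t" using M by (simp add: e_def)
    finally have "t * \<bar>D ?x u - D ?y u - t * Du v\<bar> \<le> t * (\<epsilon> * t)"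
      using t(1) by (simp add: mult_left_mono)
    moreover have "\<psi> t - \<psi> 0 - t\<^sup>2 * Du v = t * (D ?x u - D ?y u - t * Du v)"
      unfolding \<xi>(3) by (simp add: power2_eq_square algebra_simps)
    ultimately have "\<bar>\<psi> t - \<psi> 0 - t\<^sup>2 * Du v\<bar> \<le> \<epsilon> * t\<^sup>2"
      using t(1) by (simp add: abs_mult power2_eq_square mult.left_commute)
    then show "\<bar>f (a + t *\<^sub>R u + t *\<^sub>R v) - f (a + t *\<^sub>R u) - f (a + t *\<^sub>R v) + f a - t\<^sup>2 * Du v\<bar> \<le> \<epsilon> * t\<^sup>2"
      by (simp add: \<psi>_def algebra_simps)
  qed
qed

text \<open>Both mixed derivatives are the limit of the second difference quotient of \<open>f\<close>, which is
  symmetric in \<open>u\<close> and \<open>v\<close>.\<close>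

lemma second_derivative_symmetric:
  fixes f :: "'v::real_normed_vector \<Rightarrow> real"
  assumes "open S" "a \<in> S"
    and "\<And>x. x \<in> S \<Longrightarrow> (f has_derivative D x) (at x)"
    and "((\<lambda>x. D x u) has_derivative Du) (at a)" "((\<lambda>x. D x v) has_derivative Dv) (at a)"
  shows "Du v = Dv u"
proof (rule ccontr)
  assume "Du v \<noteq> Dv u"
  define \<epsilon> where "\<epsilon> = \<bar>Du v - Dv u\<bar> / 4"
  have \<epsilon>: "\<epsilon> > 0" using \<open>Du v \<noteq> Dv u\<close> by (simp add: \<epsilon>_def)
  obtain \<delta> where \<delta>: "\<delta> > 0" "\<And>t. 0 < t \<Longrightarrow> t < \<delta> \<Longrightarrow>
      \<bar>f (a + t *\<^sub>R u + t *\<^sub>R v) - f (a + t *\<^sub>R u) - f (a + t *\<^sub>R v) + f a - t\<^sup>2 * Du v\<bar> \<le> \<epsilon> * t\<^sup>2"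
    using second_difference_estimate[OF assms(1-3) assms(4) \<epsilon>, of v] by blast
  obtain \<delta>' where \<delta>': "\<delta>' > 0" "\<And>t. 0 < t \<Longrightarrow> t < \<delta>' \<Longrightarrow>
      \<bar>f (a + t *\<^sub>R v + t *\<^sub>R u) - f (a + t *\<^sub>R v) - f (a + t *\<^sub>R u) + f a - t\<^sup>2 * Dv u\<bar> \<le> \<epsilon> * t\<^sup>2"
    using second_difference_estimate[OF assms(1-3) assms(5) \<epsilon>, of u] by blast
  define t where "t = min \<delta> \<delta>' / 2"
  have t: "0 < t" "t < \<delta>" "t < \<delta>'" using \<delta>(1) \<delta>'(1) by (auto simp: t_def)
  have "a + t *\<^sub>R v + t *\<^sub>R u = a + t *\<^sub>R u + t *\<^sub>R v" by (simp add: algebra_simps)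
  then have "\<bar>t\<^sup>2 * Du v - t\<^sup>2 * Dv u\<bar> \<le> 2 * (\<epsilon> * t\<^sup>2)"
    using \<delta>(2)[OF t(1,2)] \<delta>'(2)[OF t(1,3)] by (simp only:)
  also have "t\<^sup>2 * Du v - t\<^sup>2 * Dv u = t\<^sup>2 * (Du v - Dv u)" by (simp add: algebra_simps)
  finally have "t\<^sup>2 * \<bar>Du v - Dv u\<bar> \<le> t\<^sup>2 * (2 * \<epsilon>)" by (simp add: abs_mult mult.commute mult.left_commute)
  then have "\<bar>Du v - Dv u\<bar> \<le> 2 * \<epsilon>" using t(1) by simp
  then show False using \<epsilon> by (simp add: \<epsilon>_def)
qed

section \<open>The Jacobiator in local coordinates\<close>

text \<open>The gradient for the standard inner product, that is, the vector of partial derivatives.\<close>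

definition grad :: "(real^'d \<Rightarrow> real) \<Rightarrow> real^'d \<Rightarrow> real^'d" where
  "grad f y = (\<chi> i. frechet_derivative f (at y) (axis i 1))"

lemma grad_inner:
  assumes "(f has_derivative f') (at y)"
  shows "grad f y \<bullet> v = f' v"
proof -
  interpret bounded_linear f' using assms by (rule has_derivative_bounded_linear)
  have "f' v = f' (\<Sum>i\<in>UNIV. (v $ i) *\<^sub>R axis i 1)"
    by (metis (no_types) basis_expansion scalar_mult_eq_scaleR)
  also have "\<dots> = (\<Sum>i\<in>UNIV. v $ i * f' (axis i 1))" by (simp add: sum scaleR)
  finally show ?thesis
    using frechet_derivative_at[OF assms] by (simp add: grad_def inner_vec_def mult.commute)
qed

lemma grad_cong:
  assumes "open S" "y \<in> S" "\<And>x. x \<in> S \<Longrightarrow> f x = g x" "f differentiable (at y)"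
  shows "grad f y = grad g y"
proof -
  have "(g has_derivative frechet_derivative f (at y)) (at y)"
    by (rule has_derivative_transform_within_open[OF _ assms(1-3)])
       (use assms(4) in \<open>simp_all add: frechet_derivative_works\<close>)
  then have "frechet_derivative f (at y) = frechet_derivative g (at y)"
    by (rule frechet_derivative_at)
  then show ?thesis by (simp add: grad_def)
qed

lemma Ck_on_grad:
  fixes f :: "real^'d \<Rightarrow> real"
  assumes "open U" "Ck_on (Suc k) f U"
  shows "Ck_on k (grad f) U"
proof (rule Ck_on_componentwise[OF assms(1)])
  fix b :: "real^'d" assume "b \<in> Basis"
  then obtain i where "b = axis i 1" by (auto simp: Basis_vec_def)
  then show "Ck_on k (\<lambda>y. grad f y \<bullet> b) U"
    using assms(2) by (simp add: grad_def inner_axis)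
qed

lemma grad_derivative_symmetric:
  assumes "open U" "a \<in> U" "Ck_on 2 f U"
  obtains H where "(grad f has_derivative H) (at a)" "\<And>u v. H u \<bullet> v = H v \<bullet> u"
proof -
  have f: "Ck_on (Suc (Suc 0)) f U" using assms(3) by (simp only: numeral_2_eq_2)
  define H where "H = frechet_derivative (grad f) (at a)"
  have H: "(grad f has_derivative H) (at a)"
    unfolding H_def by (rule Ck_on_has_derivative[OF Ck_on_grad[OF assms(1) f] assms(2)])
  have "H v \<bullet> u = H u \<bullet> v" for u v
  proof (rule second_derivative_symmetric[OF assms(1,2), where D = "\<lambda>y w. grad f y \<bullet> w"
        and Du = "\<lambda>w. H w \<bullet> u" and Dv = "\<lambda>w. H w \<bullet> v"])
    fix x assume "x \<in> U"
    then have "(f has_derivative frechet_derivative f (at x)) (at x)" by (rule Ck_on_has_derivative[OF f])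
    moreover from this have "frechet_derivative f (at x) = (\<lambda>w. grad f x \<bullet> w)"
      using grad_inner by fastforce
    ultimately show "(f has_derivative (\<lambda>w. grad f x \<bullet> w)) (at x)" by simp
  qed (use H in \<open>auto intro: has_derivative_inner_left\<close>)
  with H show thesis using that by blast
qed

lemma bounded_bilinear_matrix_vector_mult:
  "bounded_bilinear ((*v) :: real^'n^'m \<Rightarrow> real^'n \<Rightarrow> real^'m)"
  unfolding bilinear_conv_bounded_bilinear[symmetric] bilinear_def
  by (intro conjI allI linearI)
     (simp_all add: matrix_vector_mult_add_rdistrib matrix_vector_right_distrib
        matrix_vector_mult_scaleR flip: scaleR_matrix_vector_assoc)

lemma bounded_bilinear_matrix_mult:
  "bounded_bilinear ((**) :: real^'n^'m \<Rightarrow> real^'k^'n \<Rightarrow> real^'k^'m)"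
  unfolding bilinear_conv_bounded_bilinear[symmetric] bilinear_def
  by (intro conjI allI linearI)
     (simp_all add: matrix_matrix_mult_def vec_eq_iff distrib_left distrib_right sum.distrib
        sum_distrib_left mult.assoc mult.left_commute)

text \<open>The bracket determined by the matrix field \<open>J\<close> on an open subset of the model space.\<close>

definition local_bracket ::
    "(real^'d \<Rightarrow> real^'d^'d) \<Rightarrow> (real^'d \<Rightarrow> real) \<Rightarrow> (real^'d \<Rightarrow> real) \<Rightarrow> real^'d \<Rightarrow> real" where
  "local_bracket J f g y = grad f y \<bullet> (J y *v grad g y)"

lemma local_bracket_has_derivative:
  assumes "(grad f has_derivative Hf) (at a)" "(grad g has_derivative Hg) (at a)"
    and "(J has_derivative DJ) (at a)"
  shows "(local_bracket J f g has_derivative (\<lambda>w. Hf w \<bullet> (J a *v grad g a)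
      + grad f a \<bullet> (DJ w *v grad g a) + grad f a \<bullet> (J a *v Hg w))) (at a)"
proof -
  note bounded_bilinear.FDERIV[OF bounded_bilinear_matrix_vector_mult assms(3,2)]
  from has_derivative_inner[OF assms(1) this] show ?thesis
    unfolding local_bracket_def[abs_def] by (simp add: inner_add_right algebra_simps)
qed

lemma local_bracket_differentiable:
  assumes "open U" "a \<in> U" "Ck_on 2 f U" "Ck_on 2 g U" "J differentiable (at a)"
  shows "local_bracket J f g differentiable (at a)"
proof -
  obtain Hf Hg DJ where "(grad f has_derivative Hf) (at a)" "(grad g has_derivative Hg) (at a)"
    "(J has_derivative DJ) (at a)"
    using grad_derivative_symmetric[OF assms(1-3)] grad_derivative_symmetric[OF assms(1,2,4)] assms(5)
    unfolding differentiable_def by meson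
  then show ?thesis unfolding differentiable_def using local_bracket_has_derivative by blast
qed

lemma inner_skew_matrix:
  fixes K :: "real^'d^'d"
  assumes "transpose K = - K"
  shows "x \<bullet> (K *v y) = - ((K *v x) \<bullet> y)"
proof -
  have "x \<bullet> (K *v y) = (transpose K *v x) \<bullet> y"
    by (simp add: dot_lmul_matrix)
  also have "\<dots> = - ((K *v x) \<bullet> y)"
    using bounded_bilinear.minus_left[OF bounded_bilinear_matrix_vector_mult, of K x] assms
    by simp
  finally show ?thesis .
qed

lemma derivative_of_inverse_matrix:
  fixes J :: "'v::real_normed_vector \<Rightarrow> real^'d^'d"
  assumes "open U" "a \<in> U" and inv: "\<And>y. y \<in> U \<Longrightarrow> invertible (J y)"
    and J: "(J has_derivative DJ) (at a)"
    and W: "((\<lambda>y. matrix_inv (J y)) has_derivative DW) (at a)"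
  shows "DJ w = - (J a ** DW w ** J a)"
proof -
  have "((\<lambda>y. matrix_inv (J y) ** J y) has_derivative
      (\<lambda>w. matrix_inv (J a) ** DJ w + DW w ** J a)) (at a)"
    by (rule bounded_bilinear.FDERIV[OF bounded_bilinear_matrix_mult W J])
  moreover have "((\<lambda>y. matrix_inv (J y) ** J y) has_derivative (\<lambda>w. 0)) (at a)"
    by (rule has_derivative_transform_within_open[OF has_derivative_const[of "mat 1"] assms(1,2)])
       (simp add: matrix_inv_mult inv)
  ultimately have "(\<lambda>w. matrix_inv (J a) ** DJ w + DW w ** J a) = (\<lambda>w. 0)"
    by (rule has_derivative_unique)
  then have "matrix_inv (J a) ** DJ w = - (DW w ** J a)"
    by (simp add: fun_eq_iff eq_neg_iff_add_eq_0)
  then have "J a ** (matrix_inv (J a) ** DJ w) = J a ** (- (DW w ** J a))" by simp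
  then show ?thesis
    using matrix_inv_mult(1)[OF inv[OF \<open>a \<in> U\<close>]]
      bounded_bilinear.minus_right[OF bounded_bilinear_matrix_mult, of "J a" "DW w ** J a"]
    by (simp add: matrix_mul_assoc)
qed

text \<open>If a field of antisymmetric matrices has derivative \<open>DW\<close> at a point, this is, up to a constant
  factor, its exterior derivative there, as a trilinear form of tangent vectors.\<close>

definition cyclic_derivative :: "(real^'d \<Rightarrow> real^'d^'d) \<Rightarrow> real^'d \<Rightarrow> real^'d \<Rightarrow> real^'d \<Rightarrow> real" where
  "cyclic_derivative DW u v w = u \<bullet> (DW w *v v) + v \<bullet> (DW u *v w) + w \<bullet> (DW v *v u)"

text \<open>With \<open>X\<^sub>f = J (grad f)\<close>, differentiating \<open>{f, g}\<close> along \<open>X\<^sub>h\<close> gives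
  \<open>Hess f (X\<^sub>h, X\<^sub>g) - Hess g (X\<^sub>h, X\<^sub>f) + \<langle>grad f, DJ(X\<^sub>h) (grad g)\<rangle>\<close>. The Hessian terms cancel in
  the cyclic sum. If \<open>DW\<close> is the derivative of \<open>J\<^sup>-\<^sup>1\<close>, then \<open>DJ = - J DW J\<close> turns the last term
  into \<open>\<langle>X\<^sub>f, DW(X\<^sub>h) X\<^sub>g\<rangle>\<close>.\<close>

lemma jacobiator_eq_cyclic_derivative:
  fixes J :: "real^'d \<Rightarrow> real^'d^'d"
  assumes U: "open U" "a \<in> U"
    and f: "Ck_on 2 f U" and g: "Ck_on 2 g U" and h: "Ck_on 2 h U"
    and inv: "\<And>y. y \<in> U \<Longrightarrow> invertible (J y)" and skew: "transpose (J a) = - J a"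
    and J: "(J has_derivative DJ) (at a)"
    and W: "((\<lambda>y. matrix_inv (J y)) has_derivative DW) (at a)"
  shows "local_bracket J (local_bracket J f g) h a + local_bracket J (local_bracket J g h) f a
      + local_bracket J (local_bracket J h f) g a
    = cyclic_derivative DW (J a *v grad f a) (J a *v grad g a) (J a *v grad h a)"
proof -
  have one: "local_bracket J (local_bracket J p q) r a =
      Hp (J a *v grad r a) \<bullet> (J a *v grad q a) - Hq (J a *v grad r a) \<bullet> (J a *v grad p a)
      + (J a *v grad p a) \<bullet> (DW (J a *v grad r a) *v (J a *v grad q a))"
    if "(grad p has_derivative Hp) (at a)" "(grad q has_derivative Hq) (at a)" for p q r Hp Hq
  proof -
    let ?w = "J a *v grad r a"
    have "local_bracket J (local_bracket J p q) r a = Hp ?w \<bullet> (J a *v grad q a)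
      + grad p a \<bullet> (DJ ?w *v grad q a) + grad p a \<bullet> (J a *v Hq ?w)"
      unfolding local_bracket_def[of J "local_bracket J p q"]
      by (rule grad_inner[OF local_bracket_has_derivative[OF that J]])
    moreover have "grad p a \<bullet> (DJ ?w *v grad q a)
        = - (grad p a \<bullet> (J a *v (DW ?w *v (J a *v grad q a))))"
      by (simp add: derivative_of_inverse_matrix[OF U inv J W] matrix_vector_mul_assoc matrix_mul_assoc
          bounded_bilinear.minus_left[OF bounded_bilinear_matrix_vector_mult])
    ultimately show ?thesis
      by (simp add: inner_skew_matrix[OF skew, of "grad p a"] inner_commute[of "Hq ?w"])
  qed
  obtain Hf where Hf: "(grad f has_derivative Hf) (at a)" "\<And>u v. Hf u \<bullet> v = Hf v \<bullet> u"
    using grad_derivative_symmetric[OF U f] by blast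
  obtain Hg where Hg: "(grad g has_derivative Hg) (at a)" "\<And>u v. Hg u \<bullet> v = Hg v \<bullet> u"
    using grad_derivative_symmetric[OF U g] by blast
  obtain Hh where Hh: "(grad h has_derivative Hh) (at a)" "\<And>u v. Hh u \<bullet> v = Hh v \<bullet> u"
    using grad_derivative_symmetric[OF U h] by blast
  show ?thesis
    unfolding one[OF Hf(1) Hg(1)] one[OF Hg(1) Hh(1)] one[OF Hh(1) Hf(1)] cyclic_derivative_def
    using Hf(2)[of "J a *v grad h a" "J a *v grad g a"] Hg(2)[of "J a *v grad f a" "J a *v grad h a"]
      Hh(2)[of "J a *v grad g a" "J a *v grad f a"] by linarith
qed

text \<open>By trilinearity it suffices to test basis vectors, which yields the components.\<close>

lemma cyclic_derivative_eq_zero_iff: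
  assumes "linear DW"
  shows "(\<forall>u v w. cyclic_derivative DW u v w = 0) \<longleftrightarrow>
    (\<forall>i j k. DW (axis k 1) $ i $ j + DW (axis i 1) $ j $ k + DW (axis j 1) $ k $ i = 0)"
proof -
  interpret DW: linear DW by fact
  have basis: "cyclic_derivative DW (axis i 1) (axis j 1) (axis k 1)
      = DW (axis k 1) $ i $ j + DW (axis i 1) $ j $ k + DW (axis j 1) $ k $ i" for i j k
    by (simp add: cyclic_derivative_def inner_axis' matrix_vector_mul_component inner_axis)
  have "cyclic_derivative DW u v w = 0"
    if zero: "\<And>i j k. cyclic_derivative DW (axis i 1) (axis j 1) (axis k 1) = 0" for u v w
  proof -
    have DW': "linear (\<lambda>w. x \<bullet> (DW w *v y))" for x y
      by (rule linearI) (simp_all add: DW.add DW.scale matrix_vector_mult_add_rdistrib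
          inner_add_right flip: scaleR_matrix_vector_assoc)
    have inner_left: "linear (\<lambda>x. x \<bullet> y)" for y :: "real^'a"
      by (rule linearI) (simp_all add: inner_add_left)
    have mult_right: "linear (\<lambda>y. x \<bullet> (K *v y))" for x and K :: "real^'a^'a"
      by (rule linearI)
         (simp_all add: matrix_vector_right_distrib matrix_vector_mult_scaleR inner_add_right)
    have ext: "L x = 0" if "linear L" "\<And>i. L (axis i 1) = 0" for L :: "real^'a \<Rightarrow> real" and x
    proof -
      have "L = (\<lambda>x. 0)"
        by (rule linear_eq_stdbasis[OF that(1) linear_zero]) (auto simp: Basis_vec_def that(2))
      then show ?thesis by simp
    qed
    have lin: "linear (\<lambda>u. cyclic_derivative DW u v w)" "linear (\<lambda>v. cyclic_derivative DW u v w)"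
        "linear (\<lambda>w. cyclic_derivative DW u v w)" for u v w
      unfolding cyclic_derivative_def
      by (intro linear_compose_add DW' inner_left mult_right)+
    have "cyclic_derivative DW (axis i 1) (axis j 1) w = 0" for i j
      by (rule ext[OF lin(3)]) (rule zero)
    then have "cyclic_derivative DW (axis i 1) v w = 0" for i
      by (rule ext[OF lin(2)])
    then show ?thesis by (rule ext[OF lin(1)])
  qed
  then show ?thesis unfolding basis[symmetric] by blast
qed

section \<open>Charts and changes of coordinates\<close>

lemma is_chart_open_image:
  assumes "is_chart X c" "openin X W" "W \<subseteq> fst c"
  shows "open (snd c ` W)"
proof -
  have "open_map (subtopology X (fst c)) (top_of_set (chart_image c)) (snd c)"
    using assms(1) by (simp add: is_chart_def homeomorphic_imp_open_map)
  moreover have "openin (subtopology X (fst c)) W"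
    using assms by (simp add: is_chart_def openin_open_subtopology)
  ultimately have "openin (top_of_set (chart_image c)) (snd c ` W)"
    by (simp add: open_map_def)
  then show ?thesis using assms(1) by (auto simp: is_chart_def intro: openin_open_trans)
qed

lemma chart_inv_into:
  assumes "y \<in> chart_image c"
  shows "chart_inv c y \<in> fst c" "snd c (chart_inv c y) = y"
  using assms by (auto simp: chart_image_def chart_inv_def inv_into_into f_inv_into_f)

lemma chart_inv_snd:
  assumes "is_chart X c" "p \<in> fst c"
  shows "chart_inv c (snd c p) = p"
proof -
  have "fst c \<subseteq> topspace X" using assms(1) by (simp add: is_chart_def openin_subset)
  moreover have "inj_on (snd c) (topspace (subtopology X (fst c)))"
    using assms(1) by (auto simp: is_chart_def dest: homeomorphic_imp_injective_map)
  ultimately have "inj_on (snd c) (fst c)" by (simp add: inf.absorb2)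
  then show ?thesis using assms(2) by (simp add: chart_inv_def)
qed

lemma continuous_map_chart_inv:
  assumes "is_chart X c"
  shows "continuous_map (top_of_set (chart_image c)) X (chart_inv c)"
proof -
  obtain g where g: "homeomorphic_maps (subtopology X (fst c)) (top_of_set (chart_image c)) (snd c) g"
    using assms homeomorphic_map_maps unfolding is_chart_def by blast
  then have cont: "continuous_map (top_of_set (chart_image c)) (subtopology X (fst c)) g"
    and inv: "\<And>y. y \<in> chart_image c \<Longrightarrow> snd c (g y) = y"
    by (auto simp: homeomorphic_maps_def)
  have "g y = chart_inv c y" if "y \<in> chart_image c" for y
  proof -
    have "g y \<in> fst c"
      using cont that by (auto simp: continuous_map_def Pi_iff)
    then show ?thesis using chart_inv_snd[OF assms, of "g y"] inv[OF that] by simp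
  qed
  then have "continuous_map (top_of_set (chart_image c)) (subtopology X (fst c)) (chart_inv c)"
    by (intro continuous_map_eq[OF cont]) simp
  then show ?thesis by (rule continuous_map_into_fulltopology)
qed

text \<open>\<open>transition_matrix c c' p $ i $ a\<close> is \<open>\<partial>x'\<^sup>a / \<partial>x\<^sup>i\<close>, for the coordinates \<open>x\<close> of \<open>c\<close> and
  \<open>x'\<close> of \<open>c'\<close>.\<close>

definition transition_matrix ::
    "('a, 'd::finite) chart \<Rightarrow> ('a, 'd) chart \<Rightarrow> 'a \<Rightarrow> real^'d^'d" where
  "transition_matrix c c' p = (\<chi> i a. pd c i (\<lambda>q. snd c' q $ a) p)"

text \<open>The vector of partial derivatives of a function on the manifold in the coordinates \<open>c\<close>.\<close>

definition chart_grad :: "('a, 'd::finite) chart \<Rightarrow> ('a \<Rightarrow> real) \<Rightarrow> 'a \<Rightarrow> real^'d" where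
  "chart_grad c f p = grad (f \<circ> chart_inv c) (snd c p)"

lemma chart_bracket_eq: "chart_bracket c J f g p = chart_grad c f p \<bullet> (J c p *v chart_grad c g p)"
  by (simp add: chart_bracket_def chart_grad_def grad_def pd_def inner_vec_def
      matrix_vector_mult_def sum_distrib_left mult_ac)

lemma contravariant_iff:
  "contravariant A T \<longleftrightarrow> (\<forall>c\<in>A. \<forall>c'\<in>A. \<forall>p \<in> fst c \<inter> fst c'.
     T c' p = transpose (transition_matrix c c' p) ** T c p ** transition_matrix c c' p)"
proof -
  have "(transpose D ** K ** D) $ a $ b = (\<Sum>i\<in>UNIV. \<Sum>j\<in>UNIV. K $ i $ j * D $ i $ a * D $ j $ b)"
    for D K :: "real^'b^'b" and a b
    by (subst sum.swap)
       (simp add: matrix_matrix_mult_def transpose_def sum_distrib_left sum_distrib_right mult_ac)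
  then show ?thesis
    by (simp add: contravariant_def vec_eq_iff transition_matrix_def)
qed

lemma covariant_iff:
  "covariant A T \<longleftrightarrow> (\<forall>c\<in>A. \<forall>c'\<in>A. \<forall>p \<in> fst c \<inter> fst c'.
     T c p = transition_matrix c c' p ** T c' p ** transpose (transition_matrix c c' p))"
proof -
  have "(D ** K ** transpose D) $ i $ j = (\<Sum>a\<in>UNIV. \<Sum>b\<in>UNIV. K $ a $ b * D $ i $ a * D $ j $ b)"
    for D K :: "real^'b^'b" and i j
    by (subst sum.swap)
       (simp add: matrix_matrix_mult_def transpose_def sum_distrib_left sum_distrib_right mult_ac)
  then show ?thesis
    by (simp add: covariant_def vec_eq_iff transition_matrix_def)
qed

lemma antisymmetric_components_iff:
  "antisymmetric_components A T \<longleftrightarrow> (\<forall>c\<in>A. \<forall>p\<in>fst c. transpose (T c p) = - T c p)"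
proof -
  have "transpose K = - K \<longleftrightarrow> (\<forall>i j. K $ i $ j = - K $ j $ i)" for K :: "real^'b^'b"
  proof -
    have "transpose K = - K \<longleftrightarrow> (\<forall>j i. K $ i $ j = - K $ j $ i)"
      by (simp add: vec_eq_iff transpose_def)
    then show ?thesis by blast
  qed
  then show ?thesis by (simp add: antisymmetric_components_def)
qed

lemma nondegenerate_iff:
  "nondegenerate A T \<longleftrightarrow> (\<forall>c\<in>A. \<forall>p\<in>fst c. invertible (T c p))"
proof -
  have "rank K = CARD('b) \<longleftrightarrow> invertible K" for K :: "real^'b^'b"
    using det_eq_0_rank[of K] rank_bound[of K] by (auto simp: invertible_det_nz)
  then show ?thesis by (simp add: nondegenerate_def)
qed

lemma transpose_matrix_inv_skew:
  fixes K :: "real^'d^'d"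
  assumes "invertible K" "transpose K = - K"
  shows "transpose (matrix_inv K) = - matrix_inv K"
proof -
  let ?W = "matrix_inv K"
  note minus = bounded_bilinear.minus_left[OF bounded_bilinear_matrix_mult]
    bounded_bilinear.minus_right[OF bounded_bilinear_matrix_mult]
  have "transpose ?W ** transpose K = mat 1"
    by (metis assms(1) matrix_inv_mult(1) matrix_transpose_mul transpose_mat)
  then have "- (transpose ?W ** K) = mat 1" by (simp add: assms(2) minus)
  then have "- (transpose ?W ** K) ** ?W = ?W" by (simp only: matrix_mul_lid)
  then have "- transpose ?W = ?W"
    by (simp add: minus matrix_mul_assoc[symmetric] matrix_inv_mult(1)[OF assms(1)])
  then show ?thesis by (metis minus_minus)
qed

lemma invertible_matrix_inv:
  fixes K :: "real^'d^'d"
  shows "invertible K \<Longrightarrow> invertible (matrix_inv K)"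
  using matrix_inv_mult[of K] unfolding invertible_def by blast

text \<open>The transformation law of a nondegenerate tensor forces the transition matrix \<open>D\<close> to be
  invertible, so that the law can be inverted without differentiating the inverse transition
  map.\<close>

lemma matrix_inv_congruence:
  fixes K K' D :: "real^'d^'d"
  assumes K: "invertible K" and K': "invertible K'" and eq: "K' = transpose D ** K ** D"
  shows "matrix_inv K = D ** matrix_inv K' ** transpose D"
proof -
  let ?V = "D ** matrix_inv K' ** transpose D"
  have "det D \<noteq> 0"
    using K' unfolding invertible_det_nz eq by (simp add: det_mul)
  then obtain E where E: "D ** E = mat 1" "E ** D = mat 1"
    by (auto simp: invertible_det_nz[symmetric] invertible_def)
  \<comment> \<open>\<open>?V\<close> is a left inverse of \<open>K\<close>, since \<open>D\<close> can be cancelled on the right\<close>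
  have "?V ** K ** D = D ** (matrix_inv K' ** K')"
    unfolding eq by (simp add: matrix_mul_assoc)
  then have "?V ** K ** D = D" by (simp add: matrix_inv_mult(2)[OF K'])
  then have "?V ** K ** (D ** E) = D ** E" by (simp add: matrix_mul_assoc)
  then have "?V ** K ** matrix_inv K = matrix_inv K" by (simp add: E)
  then show ?thesis
    by (simp add: matrix_mul_assoc[symmetric] matrix_inv_mult(1)[OF K])
qed

context
  fixes X :: "'a topology" and A :: "('a, 'd::finite) chart set"
  assumes manifold: "smooth_manifold X A"
begin

lemma is_chart_atlas: "c \<in> A \<Longrightarrow> is_chart X c"
  using manifold by (simp add: smooth_manifold_def)

lemma open_chart_image: "c \<in> A \<Longrightarrow> open (chart_image c)"
  using is_chart_atlas by (auto simp: is_chart_def)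

lemma open_overlap:
  assumes "c \<in> A" "c' \<in> A"
  shows "open (snd c ` (fst c \<inter> fst c'))"
  using is_chart_atlas[OF assms(1)] is_chart_atlas[OF assms(2)]
  by (intro is_chart_open_image) (auto simp: is_chart_def)

lemma Ck_on_transition:
  assumes "c \<in> A" "c' \<in> A"
  shows "Ck_on k (snd c' \<circ> chart_inv c) (snd c ` (fst c \<inter> fst c'))"
  using manifold assms unfolding smooth_manifold_def compatible_charts_def smooth_on_def by blast

lemma chain_rule:
  assumes c: "c \<in> A" "c' \<in> A" and p: "p \<in> fst c" "p \<in> fst c'"
    and f: "(f \<circ> chart_inv c') differentiable (at (snd c' p))"
  shows "(f \<circ> chart_inv c) differentiable (at (snd c p))"
    and "chart_grad c f p = transition_matrix c c' p *v chart_grad c' f p"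
proof -
  let ?y = "snd c p" and ?W = "snd c ` (fst c \<inter> fst c')" and ?t = "snd c' \<circ> chart_inv c"
  have y: "?y \<in> ?W" using p by auto
  define t' where "t' = frechet_derivative ?t (at ?y)"
  have t': "(?t has_derivative t') (at ?y)"
    unfolding t'_def by (rule Ck_on_has_derivative[OF Ck_on_transition[OF c] y])
  have inv: "chart_inv c ?y = p" by (rule chart_inv_snd[OF is_chart_atlas[OF c(1)] p(1)])
  obtain f' where f': "((f \<circ> chart_inv c') has_derivative f') (at (snd c' p))"
    using f by (auto simp: differentiable_def)
  then have "((f \<circ> chart_inv c') has_derivative f') (at (?t ?y))" by (simp add: inv)
  from diff_chain_at[OF t' this]
  have "(((f \<circ> chart_inv c') \<circ> ?t) has_derivative (f' \<circ> t')) (at ?y)" .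
  then have D: "((f \<circ> chart_inv c) has_derivative (f' \<circ> t')) (at ?y)"
    by (rule has_derivative_transform_within_open[OF _ open_overlap[OF c] y])
       (auto simp: chart_inv_snd[OF is_chart_atlas[OF c(1)]] chart_inv_snd[OF is_chart_atlas[OF c(2)]])
  then show "(f \<circ> chart_inv c) differentiable (at (snd c p))" by (auto simp: differentiable_def)
  have T: "transition_matrix c c' p $ i $ a = t' (axis i 1) $ a" for i a
  proof -
    have "((\<lambda>x. ?t x $ a) has_derivative (\<lambda>w. t' w $ a)) (at ?y)"
      by (rule bounded_linear.has_derivative[OF bounded_linear_vec_nth t'])
    then have "frechet_derivative (\<lambda>x. ?t x $ a) (at ?y) = (\<lambda>w. t' w $ a)"
      by (metis frechet_derivative_at)
    then show ?thesis by (simp add: transition_matrix_def pd_def o_def)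
  qed
  have "chart_grad c f p $ i = (transition_matrix c c' p *v chart_grad c' f p) $ i" for i
  proof -
    have "chart_grad c f p $ i = f' (t' (axis i 1))"
      using grad_inner[OF D, of "axis i 1"] by (simp add: chart_grad_def inner_axis)
    also have "\<dots> = chart_grad c' f p \<bullet> t' (axis i 1)"
      using grad_inner[OF f'] by (simp add: chart_grad_def)
    also have "\<dots> = (transition_matrix c c' p *v chart_grad c' f p) $ i"
      by (simp add: matrix_vector_mult_def inner_vec_def T mult.commute)
    finally show ?thesis .
  qed
  then show "chart_grad c f p = transition_matrix c c' p *v chart_grad c' f p"
    by (simp add: vec_eq_iff)
qed

text \<open>The bracket at \<open>p\<close> is computed in an unspecified chart around \<open>p\<close>; for a contravariant
  tensor any other chart gives the same value. The functions need only be differentiable at \<open>p\<close>,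
  so that the lemma also covers the outer bracket of a nested one.\<close>

lemma bracket_eq_chart_bracket:
  assumes J: "contravariant A J" and c: "c \<in> A" and p: "p \<in> fst c"
    and f: "(f \<circ> chart_inv c) differentiable (at (snd c p))"
    and g: "(g \<circ> chart_inv c) differentiable (at (snd c p))"
  shows "bracket A J f g p = chart_grad c f p \<bullet> (J c p *v chart_grad c g p)"
proof -
  define c0 where "c0 = (SOME c. c \<in> A \<and> p \<in> fst c)"
  have c0: "c0 \<in> A" "p \<in> fst c0"
    using someI[of "\<lambda>c. c \<in> A \<and> p \<in> fst c" c] c p by (auto simp: c0_def)
  let ?D = "transition_matrix c0 c p"
  have "bracket A J f g p = (?D *v chart_grad c f p) \<bullet> (J c0 p *v (?D *v chart_grad c g p))"
    by (simp add: bracket_def chart_bracket_eq chain_rule(2)[OF c0(1) c c0(2) p f]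
        chain_rule(2)[OF c0(1) c c0(2) p g] flip: c0_def)
  also have "\<dots> = chart_grad c f p \<bullet> (transpose ?D *v (J c0 p *v (?D *v chart_grad c g p)))"
    by (metis dot_lmul_matrix vector_transpose_matrix)
  also have "\<dots> = chart_grad c f p \<bullet> ((transpose ?D ** J c0 p ** ?D) *v chart_grad c g p)"
    by (simp add: matrix_vector_mul_assoc matrix_mul_assoc)
  also have "transpose ?D ** J c0 p ** ?D = J c p"
    using J[unfolded contravariant_iff, rule_format, OF c0(1) c, of p] c0(2) p by simp
  finally show ?thesis .
qed

lemma Ck_on_smooth_function:
  "smooth_function A f \<Longrightarrow> c \<in> A \<Longrightarrow> Ck_on k (f \<circ> chart_inv c) (chart_image c)"
  by (simp add: smooth_function_def smooth_in_chart_def smooth_on_def)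

lemma snd_in_chart_image: "p \<in> fst c \<Longrightarrow> snd c p \<in> chart_image c"
  by (simp add: chart_image_def)

lemma Ck_on_components:
  "almost_poisson A J \<Longrightarrow> c \<in> A \<Longrightarrow> Ck_on k (J c \<circ> chart_inv c) (chart_image c)"
  by (simp add: almost_poisson_def smooth_components_def smooth_in_chart_def smooth_on_def)

lemma differentiable_smooth_function:
  assumes "smooth_function A f" "c \<in> A" "y \<in> chart_image c"
  shows "(f \<circ> chart_inv c) differentiable (at y)"
  using Ck_on_smooth_function[OF assms(1,2), of "Suc 0"] assms(3) by simp

lemma bracket_smooth_local:
  assumes "contravariant A J" "c \<in> A" "y \<in> chart_image c" "smooth_function A f" "smooth_function A g"
  shows "bracket A J f g (chart_inv c y)
    = local_bracket (J c \<circ> chart_inv c) (f \<circ> chart_inv c) (g \<circ> chart_inv c) y"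
  using bracket_eq_chart_bracket[OF assms(1,2) chart_inv_into(1)[OF assms(3)], of f g]
    differentiable_smooth_function[OF assms(4,2,3)] differentiable_smooth_function[OF assms(5,2,3)]
  by (simp add: chart_inv_into[OF assms(3)] local_bracket_def chart_grad_def)

lemma nested_bracket_local:
  assumes J: "almost_poisson A J" and c: "c \<in> A" and p: "p \<in> fst c"
    and f: "smooth_function A f" and g: "smooth_function A g" and h: "smooth_function A h"
  shows "bracket A J (bracket A J f g) h p
    = local_bracket (J c \<circ> chart_inv c)
        (local_bracket (J c \<circ> chart_inv c) (f \<circ> chart_inv c) (g \<circ> chart_inv c))
        (h \<circ> chart_inv c) (snd c p)"
proof -
  let ?J = "J c \<circ> chart_inv c" and ?y = "snd c p"
  let ?B = "local_bracket ?J (f \<circ> chart_inv c) (g \<circ> chart_inv c)"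
  have contra: "contravariant A J" using J by (simp add: almost_poisson_def)
  note y = snd_in_chart_image[OF p] and U = open_chart_image[OF c]
  have "Ck_on (Suc 0) ?J (chart_image c)"
    by (rule Ck_on_components[OF J c])
  then have "?J differentiable (at ?y)" using y by simp
  then have dB: "?B differentiable (at ?y)"
    by (intro local_bracket_differentiable[OF U y] Ck_on_smooth_function f g c)
  have eq: "?B x = (bracket A J f g \<circ> chart_inv c) x" if "x \<in> chart_image c" for x
    using bracket_smooth_local[OF contra c that f g] by simp
  have "(bracket A J f g \<circ> chart_inv c) differentiable (at ?y)"
    using dB has_derivative_transform_within_open[of ?B _ ?y UNIV, OF _ U y eq]
    unfolding differentiable_def by blast
  then have "bracket A J (bracket A J f g) h p
      = chart_grad c (bracket A J f g) p \<bullet> (J c p *v chart_grad c h p)"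
    by (rule bracket_eq_chart_bracket[OF contra c p _ differentiable_smooth_function[OF h c y]])
  moreover have "chart_grad c (bracket A J f g) p = grad ?B ?y"
    unfolding chart_grad_def using grad_cong[OF U y eq dB] by (simp add: o_def)
  ultimately show ?thesis
    by (simp add: local_bracket_def[of ?J ?B] chart_grad_def chart_inv_snd[OF is_chart_atlas[OF c] p])
qed

section \<open>Global functions with prescribed gradient at a point\<close>

text \<open>A bump function times an affine function of the coordinates, extended by zero. Smoothness of
  the extension uses that it vanishes outside a compact subset of the chart domain, which is closed
  because the manifold is Hausdorff.\<close>

lemma exists_smooth_function_with_gradient:
  assumes c: "c \<in> A" and p: "p \<in> fst c"
  obtains f where "smooth_function A f" "chart_grad c f p = \<xi>"
proof -
  let ?a = "snd c p"
  obtain r where r: "r > 0" "cball ?a r \<subseteq> chart_image c"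
    using open_chart_image[OF c] snd_in_chart_image[OF p] by (auto simp: open_contains_cball)
  obtain \<beta> :: "real^'d \<Rightarrow> real" where \<beta>: "\<And>k. Ck_on k \<beta> UNIV" "\<beta> ?a \<noteq> 0"
    "\<And>x. x \<notin> cball ?a r \<Longrightarrow> \<beta> x = 0"
    using smooth_bump_exists[OF r(1)] by blast
  define \<phi> where "\<phi> x = \<beta> x * (inverse (\<beta> ?a) * ((x + - ?a) \<bullet> \<xi>))" for x
  have \<phi>: "Ck_on k \<phi> UNIV" for k
    unfolding \<phi>_def
    by (intro Ck_on_mult Ck_on_const Ck_on_inner Ck_on_add Ck_on_id open_UNIV \<beta>)
  define f where "f q = (if q \<in> fst c then \<phi> (snd c q) else 0)" for q
  define K where "K = chart_inv c ` cball ?a r"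
  have "compactin (top_of_set (chart_image c)) (cball ?a r)"
    using r(2) by (simp add: compactin_subtopology)
  then have "compactin X K"
    unfolding K_def using continuous_map_chart_inv[OF is_chart_atlas[OF c]] by (rule image_compactin)
  then have K: "closedin X K"
    using manifold by (auto simp: smooth_manifold_def intro: compactin_imp_closedin)
  have "Ck_on k (f \<circ> chart_inv c') (chart_image c')" if c': "c' \<in> A" for c' k
  proof -
    let ?V = "snd c' ` (fst c' \<inter> fst c)" and ?W = "snd c' ` (fst c' - K)"
    have W: "open ?W"
      using is_chart_atlas[OF c'] K by (intro is_chart_open_image) (auto simp: is_chart_def)
    have V: "open ?V" by (rule open_overlap[OF c' c])
    have "K \<subseteq> fst c" using r(2) chart_inv_into(1)[of _ c] unfolding K_def by blast
    then have cover: "chart_image c' = ?V \<union> ?W" by (auto simp: chart_image_def)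
    have "Ck_on k (\<lambda>x. \<phi> ((snd c \<circ> chart_inv c') x)) ?V"
      by (rule Ck_on_compose[OF V open_UNIV _ Ck_on_transition[OF c' c] \<phi>]) simp
    then have "Ck_on k (f \<circ> chart_inv c') ?V"
      by (rule Ck_on_cong[OF V, rotated]) (auto simp: f_def chart_inv_snd[OF is_chart_atlas[OF c']])
    moreover have "Ck_on k (f \<circ> chart_inv c') ?W"
    proof (rule Ck_on_cong[OF W _ Ck_on_const[of k 0]])
      fix x assume "x \<in> ?W"
      then obtain q where q: "q \<in> fst c'" "q \<notin> K" "x = snd c' q" by auto
      have "f q = 0"
      proof (cases "q \<in> fst c")
        case True
        then have "snd c q \<notin> cball ?a r"
          using q(2) chart_inv_snd[OF is_chart_atlas[OF c] True] by (force simp: K_def)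
        then show ?thesis by (simp add: f_def \<phi>_def \<beta>(3))
      qed (simp add: f_def)
      then show "0 = (f \<circ> chart_inv c') x" using q chart_inv_snd[OF is_chart_atlas[OF c']] by simp
    qed
    ultimately show ?thesis unfolding cover by (rule Ck_on_Un[OF V W])
  qed
  then have "smooth_function A f" by (simp add: smooth_function_def smooth_in_chart_def smooth_on_def)
  moreover have "chart_grad c f p = \<xi>"
  proof -
    obtain \<beta>' where "(\<beta> has_derivative \<beta>') (at ?a)"
      using Ck_on_has_derivative[OF \<beta>(1)] by blast
    then have "(\<phi> has_derivative (\<lambda>w. w \<bullet> \<xi>)) (at ?a)"
      unfolding \<phi>_def[abs_def] by (auto intro!: derivative_eq_intros simp: \<beta>(2))
    then have "((f \<circ> chart_inv c) has_derivative (\<lambda>w. w \<bullet> \<xi>)) (at ?a)"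
      by (rule has_derivative_transform_within_open[OF _ open_chart_image[OF c] snd_in_chart_image[OF p]])
         (simp add: f_def chart_inv_into)
    then have "chart_grad c f p \<bullet> w = w \<bullet> \<xi>" for w
      unfolding chart_grad_def by (rule grad_inner)
    then show ?thesis by (metis inner_commute vector_eq_rdot)
  qed
  ultimately show thesis using that by blast
qed

section \<open>Closedness and the Jacobi identity in a chart\<close>

lemma fundamental_form_has_derivative:
  assumes J: "almost_poisson A J" "nondegenerate A J" and c: "c \<in> A" and p: "p \<in> fst c"
  obtains DW where "((fundamental_form J c \<circ> chart_inv c) has_derivative DW) (at (snd c p))"
proof -
  have "Ck_on (Suc 0) (J c \<circ> chart_inv c) (chart_image c)"
    by (rule Ck_on_components[OF J(1) c])
  moreover have "invertible ((J c \<circ> chart_inv c) y)" if "y \<in> chart_image c" for y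
    using J(2) c chart_inv_into(1)[OF that] by (simp add: nondegenerate_iff)
  ultimately have "Ck_on (Suc 0) (\<lambda>y. matrix_inv ((J c \<circ> chart_inv c) y)) (chart_image c)"
    by (intro Ck_on_matrix_inv open_chart_image c)
  from Ck_on_has_derivative[OF this snd_in_chart_image[OF p]] show thesis
    using that by (simp add: fundamental_form_def o_def)
qed

lemma jacobiator_eq:
  assumes J: "almost_poisson A J" "nondegenerate A J" and c: "c \<in> A" and p: "p \<in> fst c"
    and DW: "((fundamental_form J c \<circ> chart_inv c) has_derivative DW) (at (snd c p))"
    and f: "smooth_function A f" and g: "smooth_function A g" and h: "smooth_function A h"
  shows "bracket A J (bracket A J f g) h p + bracket A J (bracket A J g h) f p
      + bracket A J (bracket A J h f) g p
    = cyclic_derivative DW (J c p *v chart_grad c f p) (J c p *v chart_grad c g p)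
        (J c p *v chart_grad c h p)"
proof -
  let ?J = "J c \<circ> chart_inv c" and ?y = "snd c p"
  note y = snd_in_chart_image[OF p] and U = open_chart_image[OF c]
  have Jp: "?J ?y = J c p" by (simp add: chart_inv_snd[OF is_chart_atlas[OF c] p])
  have "Ck_on (Suc 0) ?J (chart_image c)"
    by (rule Ck_on_components[OF J(1) c])
  then obtain DJ where DJ: "(?J has_derivative DJ) (at ?y)"
    using Ck_on_has_derivative[OF _ y] by blast
  have inv: "invertible (?J x)" if "x \<in> chart_image c" for x
    using J(2) c chart_inv_into(1)[OF that] by (simp add: nondegenerate_iff)
  have skew: "transpose (?J ?y) = - ?J ?y"
    unfolding Jp using J(1) c p by (simp add: almost_poisson_def antisymmetric_components_iff)
  have W: "((\<lambda>x. matrix_inv (?J x)) has_derivative DW) (at ?y)"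
    using DW by (simp add: fundamental_form_def o_def)
  note Ck = Ck_on_smooth_function[OF _ c, of _ 2]
  show ?thesis
    using jacobiator_eq_cyclic_derivative[OF U y Ck[OF f] Ck[OF g] Ck[OF h] inv skew DJ W]
    unfolding nested_bracket_local[OF J(1) c p f g h] nested_bracket_local[OF J(1) c p g h f]
      nested_bracket_local[OF J(1) c p h f g] Jp chart_grad_def .
qed

lemma closed_at_iff:
  assumes c: "c \<in> A" and p: "p \<in> fst c"
    and DW: "((\<Omega> c \<circ> chart_inv c) has_derivative DW) (at (snd c p))"
  shows "(\<forall>i j k. pd c k (\<lambda>q. \<Omega> c q $ i $ j) p + pd c i (\<lambda>q. \<Omega> c q $ j $ k) p
        + pd c j (\<lambda>q. \<Omega> c q $ k $ i) p = 0)
    \<longleftrightarrow> (\<forall>u v w. cyclic_derivative DW u v w = 0)"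
proof -
  have "pd c k (\<lambda>q. \<Omega> c q $ i $ j) p = DW (axis k 1) $ i $ j" for i j k
  proof -
    have "((\<lambda>y. (\<Omega> c \<circ> chart_inv c) y $ i $ j) has_derivative (\<lambda>w. DW w $ i $ j)) (at (snd c p))"
      by (intro bounded_linear.has_derivative[OF bounded_linear_vec_nth] DW)
    then have "frechet_derivative (\<lambda>y. (\<Omega> c \<circ> chart_inv c) y $ i $ j) (at (snd c p)) = (\<lambda>w. DW w $ i $ j)"
      by (metis frechet_derivative_at)
    then show ?thesis by (simp add: pd_def o_def)
  qed
  then show ?thesis
    using cyclic_derivative_eq_zero_iff[OF has_derivative_linear[OF DW]] by simp
qed

lemma two_form_fundamental_form:
  assumes J: "almost_poisson A J" "nondegenerate A J"
  shows "two_form A (fundamental_form J)" "nondegenerate A (fundamental_form J)"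
proof -
  have inv: "invertible (J c p)" if "c \<in> A" "p \<in> fst c" for c p
    using J(2) that by (simp add: nondegenerate_iff)
  show "nondegenerate A (fundamental_form J)"
    using inv by (simp add: nondegenerate_iff fundamental_form_def invertible_matrix_inv)
  have "covariant A (fundamental_form J)"
    unfolding covariant_iff fundamental_form_def
  proof (intro ballI)
    fix c c' p assume *: "c \<in> A" "c' \<in> A" "p \<in> fst c \<inter> fst c'"
    then have "J c' p = transpose (transition_matrix c c' p) ** J c p ** transition_matrix c c' p"
      using J(1) unfolding almost_poisson_def contravariant_iff by blast
    with * show "matrix_inv (J c p) = transition_matrix c c' p ** matrix_inv (J c' p)
        ** transpose (transition_matrix c c' p)"
      by (intro matrix_inv_congruence inv) auto
  qed
  moreover have "antisymmetric_components A (fundamental_form J)"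
    using J(1) inv
    by (simp add: antisymmetric_components_iff almost_poisson_def fundamental_form_def
        transpose_matrix_inv_skew)
  moreover have "smooth_components A (fundamental_form J)"
    unfolding smooth_components_def smooth_in_chart_def smooth_on_def
  proof (intro ballI allI)
    fix c k assume c: "c \<in> A"
    have "Ck_on k (\<lambda>y. matrix_inv ((J c \<circ> chart_inv c) y)) (chart_image c)"
    proof (rule Ck_on_matrix_inv[OF open_chart_image[OF c]])
      show "Ck_on k (J c \<circ> chart_inv c) (chart_image c)"
        by (rule Ck_on_components[OF J(1) c])
    qed (simp add: inv[OF c] chart_inv_into)
    then show "Ck_on k (fundamental_form J c \<circ> chart_inv c) (chart_image c)"
      by (simp add: fundamental_form_def o_def)
  qed
  ultimately show "two_form A (fundamental_form J)" by (simp add: two_form_def)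
qed

lemma closed_imp_poisson:
  assumes J: "almost_poisson A J" "nondegenerate A J" and closed: "closed_form A (fundamental_form J)"
  shows "poisson X A J"
  unfolding poisson_def
proof (intro conjI allI impI ballI J(1))
  fix f g h p
  assume smooth: "smooth_function A f \<and> smooth_function A g \<and> smooth_function A h"
    and "p \<in> topspace X"
  then obtain c where c: "c \<in> A" and p: "p \<in> fst c"
    using manifold unfolding smooth_manifold_def by blast
  obtain DW where DW: "((fundamental_form J c \<circ> chart_inv c) has_derivative DW) (at (snd c p))"
    using fundamental_form_has_derivative[OF J c p] by blast
  have "\<forall>u v w. cyclic_derivative DW u v w = 0"
    using closed c p unfolding closed_at_iff[where \<Omega> = "fundamental_form J", OF c p DW, symmetric] closed_form_def by blast
  then show "bracket A J (bracket A J f g) h p + bracket A J (bracket A J g h) f p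
      + bracket A J (bracket A J h f) g p = 0"
    using smooth by (simp add: jacobiator_eq[OF J c p DW])
qed

lemma poisson_imp_closed:
  assumes J: "almost_poisson A J" "nondegenerate A J" and poisson: "poisson X A J"
  shows "closed_form A (fundamental_form J)"
  unfolding closed_form_def
proof (intro ballI)
  fix c p assume c: "c \<in> A" and p: "p \<in> fst c"
  obtain DW where DW: "((fundamental_form J c \<circ> chart_inv c) has_derivative DW) (at (snd c p))"
    using fundamental_form_has_derivative[OF J c p] by blast
  have X: "p \<in> topspace X" using manifold c p unfolding smooth_manifold_def by blast
  \<comment> \<open>Hamiltonian vector fields take every value at \<open>p\<close>\<close>
  have hamiltonian: "\<exists>f. smooth_function A f \<and> J c p *v chart_grad c f p = u" for u
  proof -
    obtain f where f: "smooth_function A f" "chart_grad c f p = matrix_inv (J c p) *v u"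
      using exists_smooth_function_with_gradient[OF c p] by blast
    moreover have "invertible (J c p)" using J(2) c p by (simp add: nondegenerate_iff)
    ultimately show ?thesis by (auto simp: matrix_vector_mul_assoc matrix_inv_mult(1))
  qed
  have "cyclic_derivative DW u v w = 0" for u v w
  proof -
    obtain f g h where *: "smooth_function A f" "J c p *v chart_grad c f p = u"
      "smooth_function A g" "J c p *v chart_grad c g p = v"
      "smooth_function A h" "J c p *v chart_grad c h p = w"
      using hamiltonian by meson
    then show ?thesis
      using poisson X jacobiator_eq[OF J c p DW *(1,3,5)] unfolding poisson_def by simp
  qed
  then show "\<forall>i j k. pd c k (\<lambda>q. fundamental_form J c q $ i $ j) p
      + pd c i (\<lambda>q. fundamental_form J c q $ j $ k) p
      + pd c j (\<lambda>q. fundamental_form J c q $ k $ i) p = 0"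
    unfolding closed_at_iff[where \<Omega> = "fundamental_form J", OF c p DW] by blast
qed

end

theorem theorem2p3:
  fixes X :: "'a topology" and A :: "('a, 'd::finite) chart set"
    and J \<Omega> :: "('a, 'd) tensor2" and n :: nat
  assumes "smooth_manifold X A" and "CARD('d) = 2 * n"
    and "almost_poisson A J" and "nondegenerate A J"
    and "\<Omega> = fundamental_form J"
  shows "symplectic A \<Omega> \<longleftrightarrow> poisson X A J"
proof -
  have "symplectic A \<Omega> \<longleftrightarrow> closed_form A (fundamental_form J)"
    using two_form_fundamental_form[OF assms(1,3,4)] by (simp add: symplectic_def assms(5))
  also have "\<dots> \<longleftrightarrow> poisson X A J"
    using closed_imp_poisson[OF assms(1,3,4)] poisson_imp_closed[OF assms(1,3,4)] by blast
  finally show ?thesis .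
qed

end
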